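(* Let $a,c\in\mathbb{R}$ with $a\neq 0$, $c\neq 0$, let $p\geq 0$ be an integer, and consider the planar system $$\dot x = y,\qquad \dot y = a\left(\frac{p+4}{2}\right)y-\frac{3}{2}a^{2}x-c x^{2}.$$ (a) If $p\geq 1$, then the critical point $(0,0)$ is a node, stable if $a<0$ and unstable if $a>0$, and the critical point $\left(\frac{-3a^{2}}{2c},0\right)$ is a saddle. (b) If $p=0$, then the critical point $(0,0)$ is a focus, stable if $a<0$ and unstable if $a>0$, and the critical point $\left(\frac{-3a^{2}}{2c},0\right)$ is a saddle.
   Context: For a critical point of a planar vector field whose linear part has eigenvalues $\lambda_1,\lambda_2$: it is a saddle if $\lambda_1,\lambda_2$ are real with $\lambda_1\lambda_2<0$; a node if $\lambda_1,\lambda_2$ are real with $\lambda_1\lambda_2>0$ (stable if both are negative, unstable if both are positive); a focus if $\lambda_{1,2}=\alpha\pm i\beta$ with $\alpha,\beta$ real and nonzero (stable if $\alpha<0$, unstable if $\alpha>0$). *)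

theory Defs
  imports "HOL-Analysis.Analysis"
begin

definition eigenvalue :: "'a::field ^ 'n ^ 'n \<Rightarrow> 'a \<Rightarrow> bool" where
  "eigenvalue A k \<longleftrightarrow> (\<exists>v. v \<noteq> 0 \<and> A *v v = k *s v)"

definition critical_point :: "(real^2 \<Rightarrow> real^2) \<Rightarrow> real^2 \<Rightarrow> bool" where
  "critical_point F z \<longleftrightarrow> F z = 0"

(* The eigenvalues are those of the Jacobian regarded as a complex matrix. A 2x2 complex matrix
   whose set of eigenvalues is {l1, l2} has exactly l1, l2 as its eigenvalues counted with
   algebraic multiplicity (l1 = l2 being the case of a double eigenvalue). Differentiability is
   required because the library's jacobian is a total function. *)
definition linear_part_eigenvalues ::
    "(real^2 \<Rightarrow> real^2) \<Rightarrow> real^2 \<Rightarrow> complex \<Rightarrow> complex \<Rightarrow> bool" where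
  "linear_part_eigenvalues F z l1 l2 \<longleftrightarrow>
     F differentiable (at z) \<and>
     {k. eigenvalue (map_matrix complex_of_real (jacobian F (at z))) k} = {l1, l2}"

definition saddle :: "(real^2 \<Rightarrow> real^2) \<Rightarrow> real^2 \<Rightarrow> bool" where
  "saddle F z \<longleftrightarrow> critical_point F z \<and>
     (\<exists>l1 l2 :: real. linear_part_eigenvalues F z (of_real l1) (of_real l2) \<and> l1 * l2 < 0)"

definition node :: "(real^2 \<Rightarrow> real^2) \<Rightarrow> real^2 \<Rightarrow> bool" where
  "node F z \<longleftrightarrow> critical_point F z \<and>
     (\<exists>l1 l2 :: real. linear_part_eigenvalues F z (of_real l1) (of_real l2) \<and> l1 * l2 > 0)"

definition stable_node :: "(real^2 \<Rightarrow> real^2) \<Rightarrow> real^2 \<Rightarrow> bool" where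
  "stable_node F z \<longleftrightarrow> critical_point F z \<and>
     (\<exists>l1 l2 :: real. linear_part_eigenvalues F z (of_real l1) (of_real l2) \<and>
        l1 * l2 > 0 \<and> l1 < 0 \<and> l2 < 0)"

definition unstable_node :: "(real^2 \<Rightarrow> real^2) \<Rightarrow> real^2 \<Rightarrow> bool" where
  "unstable_node F z \<longleftrightarrow> critical_point F z \<and>
     (\<exists>l1 l2 :: real. linear_part_eigenvalues F z (of_real l1) (of_real l2) \<and>
        l1 * l2 > 0 \<and> l1 > 0 \<and> l2 > 0)"

definition focus :: "(real^2 \<Rightarrow> real^2) \<Rightarrow> real^2 \<Rightarrow> bool" where
  "focus F z \<longleftrightarrow> critical_point F z \<and>
     (\<exists>\<alpha> \<beta> :: real. linear_part_eigenvalues F z (Complex \<alpha> \<beta>) (Complex \<alpha> (- \<beta>)) \<and>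
        \<alpha> \<noteq> 0 \<and> \<beta> \<noteq> 0)"

definition stable_focus :: "(real^2 \<Rightarrow> real^2) \<Rightarrow> real^2 \<Rightarrow> bool" where
  "stable_focus F z \<longleftrightarrow> critical_point F z \<and>
     (\<exists>\<alpha> \<beta> :: real. linear_part_eigenvalues F z (Complex \<alpha> \<beta>) (Complex \<alpha> (- \<beta>)) \<and>
        \<alpha> \<noteq> 0 \<and> \<beta> \<noteq> 0 \<and> \<alpha> < 0)"

definition unstable_focus :: "(real^2 \<Rightarrow> real^2) \<Rightarrow> real^2 \<Rightarrow> bool" where
  "unstable_focus F z \<longleftrightarrow> critical_point F z \<and>
     (\<exists>\<alpha> \<beta> :: real. linear_part_eigenvalues F z (Complex \<alpha> \<beta>) (Complex \<alpha> (- \<beta>)) \<and>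
        \<alpha> \<noteq> 0 \<and> \<beta> \<noteq> 0 \<and> \<alpha> > 0)"

(* The vector field on the right-hand side of the planar system, with (x, y) = (z $ 1, z $ 2). *)
definition planar_field :: "real \<Rightarrow> real \<Rightarrow> nat \<Rightarrow> real^2 \<Rightarrow> real^2" where
  "planar_field a c p z =
     vector [z $ 2,
             a * ((real p + 4) / 2) * (z $ 2) - 3 / 2 * a\<^sup>2 * (z $ 1) - c * (z $ 1)\<^sup>2]"

end

theory Submission
  imports Defs
begin

text \<open>At a point with first coordinate \<open>x\<close> the Jacobian is a companion matrix
  with trace \<open>s = a * (p + 4) / 2\<close> and determinant
  \<open>q = 3/2 * a^2 + 2 * c * x\<close>, so the eigenvalues are the roots of
  \<open>k^2 - s * k + q\<close>. By \<open>linear_part_eigenvalues_planar_field\<close> it suffices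
  to exhibit two numbers with sum \<open>s\<close> and product \<open>q\<close>;
  \<open>real_quadratic_roots\<close> and \<open>complex_quadratic_roots\<close> supply them. At the
  second critical point \<open>q = - 3/2 * a^2 < 0\<close>, which gives a saddle for every
  \<open>p\<close>. At the origin \<open>q = 3/2 * a^2 > 0\<close> and the discriminant is
  \<open>a^2 * ((p + 4)^2 - 24) / 4\<close>: positive for \<open>p \<ge> 1\<close>, negative for
  \<open>p = 0\<close>. Real roots then share the sign of \<open>s\<close>, hence of
  \<open>a\<close>; nonreal ones have real part \<open>s / 2 = a\<close>.\<close>

lemma vector_2_eq_axis: "vector [u, v] = u *\<^sub>R axis 1 1 + v *\<^sub>R (axis 2 1 :: real^2)"
  by (simp add: vec_eq_iff forall_2 axis_def)

lemma planar_field_has_derivative: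
  "(planar_field a c p has_derivative
      (\<lambda>h. vector [h $ 2,
                   (- 3 / 2 * a\<^sup>2 - 2 * c * (z $ 1)) * h $ 1 + a * ((real p + 4) / 2) * h $ 2]))
    (at z)"
  \<comment> \<open>As a combination of fixed axis vectors with scalar coefficients, the field is
    within reach of the standard differentiation rules.\<close>
  unfolding planar_field_def vector_2_eq_axis
  by (auto intro!: derivative_eq_intros bounded_linear.has_derivative[OF bounded_linear_vec_nth]
      ext simp: algebra_simps)

lemma jacobian_planar_field:
  "jacobian (planar_field a c p) (at z) =
     vector [vector [0, 1],
             vector [- 3 / 2 * a\<^sup>2 - 2 * c * (z $ 1), a * ((real p + 4) / 2)]]"
  unfolding jacobian_def frechet_derivative_at[OF planar_field_has_derivative, symmetric]
  by (simp add: matrix_def vec_eq_iff forall_2 axis_def)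

text \<open>The first row forces every eigenvector to be a multiple of \<open>(1, k)\<close>; the
  second row then becomes the characteristic equation.\<close>

lemma eigenvalue_companion_2:
  fixes A :: "'a::field^2^2"
  assumes "A $ 1 $ 1 = 0" "A $ 1 $ 2 = 1"
  shows "eigenvalue A k \<longleftrightarrow> k\<^sup>2 = A $ 2 $ 2 * k + A $ 2 $ 1"
proof
  assume "eigenvalue A k"
  then obtain v where v: "v \<noteq> 0" "A *v v = k *s v"
    unfolding eigenvalue_def by blast
  then have 1: "v $ 2 = k * v $ 1" and 2: "A $ 2 $ 1 * v $ 1 + A $ 2 $ 2 * v $ 2 = k * v $ 2"
    using assms by (auto simp: vec_eq_iff forall_2 matrix_vector_mult_def sum_2)
  \<comment> \<open>Otherwise \<open>v $ 2 = k * v $ 1\<close> would vanish too. This permits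
    cancelling \<open>v $ 1\<close> below.\<close>
  with v(1) have "v $ 1 \<noteq> 0"
    by (auto simp: vec_eq_iff forall_2)
  moreover from 1 2 have "v $ 1 * (A $ 2 $ 2 * k + A $ 2 $ 1) = v $ 1 * k\<^sup>2"
    by (simp add: algebra_simps power2_eq_square)
  ultimately show "k\<^sup>2 = A $ 2 $ 2 * k + A $ 2 $ 1"
    by simp
next
  assume "k\<^sup>2 = A $ 2 $ 2 * k + A $ 2 $ 1"
  then have "A *v vector [1, k] = k *s vector [1, k]"
    using assms
    by (simp add: vec_eq_iff forall_2 matrix_vector_mult_def sum_2 power2_eq_square add.commute)
  moreover have "vector [1, k] \<noteq> (0 :: 'a^2)"
    by (simp add: vec_eq_iff forall_2)
  ultimately show "eigenvalue A k"
    unfolding eigenvalue_def by blast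
qed

text \<open>Vieta: the prescribed sum and product factor the characteristic polynomial as
  \<open>(k - l1) * (k - l2)\<close>. Taking \<open>l1\<close>, \<open>l2\<close> complex covers
  real and conjugate pairs alike.\<close>

lemma linear_part_eigenvalues_planar_field:
  assumes sum: "l1 + l2 = of_real (a * ((real p + 4) / 2))"
    and prod: "l1 * l2 = of_real (3 / 2 * a\<^sup>2 + 2 * c * (z $ 1))"
  shows "linear_part_eigenvalues (planar_field a c p) z l1 l2"
proof -
  let ?J = "map_matrix complex_of_real (jacobian (planar_field a c p) (at z))"
  have J: "?J $ 1 $ 1 = 0" "?J $ 1 $ 2 = 1" "?J $ 2 $ 2 = l1 + l2" "?J $ 2 $ 1 = - (l1 * l2)"
    unfolding sum prod by (simp_all add: jacobian_planar_field map_matrix_def)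
  have "eigenvalue ?J k \<longleftrightarrow> k \<in> {l1, l2}" for k
  proof -
    have "eigenvalue ?J k \<longleftrightarrow> k\<^sup>2 = (l1 + l2) * k + - (l1 * l2)"
      using eigenvalue_companion_2[of ?J k] J by simp
    also have "\<dots> \<longleftrightarrow> (k - l1) * (k - l2) = 0"
      by (auto simp: algebra_simps power2_eq_square)
    finally show ?thesis by simp
  qed
  then have "{k. eigenvalue ?J k} = {l1, l2}"
    by blast
  then show ?thesis
    unfolding linear_part_eigenvalues_def differentiable_def
    using planar_field_has_derivative by blast
qed

text \<open>The quadratic formula, with the hypothesis making the discriminant nonnegative.\<close>

lemma real_quadratic_roots:
  fixes s q :: real
  assumes "4 * q \<le> s\<^sup>2"
  obtains l1 l2 where "l1 + l2 = s" "l1 * l2 = q"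
proof
  have "(sqrt (s\<^sup>2 - 4 * q))\<^sup>2 = s\<^sup>2 - 4 * q"
    using assms by simp
  then show "(s + sqrt (s\<^sup>2 - 4 * q)) / 2 * ((s - sqrt (s\<^sup>2 - 4 * q)) / 2) = q"
    by (simp add: field_simps power2_eq_square)
qed (simp add: field_simps)

text \<open>The imaginary part is \<open>sqrt (q - s^2 / 4)\<close>; strictness of the hypothesis
  makes it nonzero.\<close>

lemma complex_quadratic_roots:
  fixes s q :: real
  assumes "s\<^sup>2 < 4 * q"
  obtains \<beta> where "\<beta> \<noteq> 0" "Complex (s / 2) \<beta> + Complex (s / 2) (- \<beta>) = of_real s"
    "Complex (s / 2) \<beta> * Complex (s / 2) (- \<beta>) = of_real q"
proof
  have "(sqrt (q - s\<^sup>2 / 4))\<^sup>2 = q - s\<^sup>2 / 4"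
    using assms by simp
  then show "Complex (s / 2) (sqrt (q - s\<^sup>2 / 4)) * Complex (s / 2) (- sqrt (q - s\<^sup>2 / 4)) = of_real q"
    by (simp add: complex_eq_iff power2_eq_square)
qed (use assms in \<open>auto simp: complex_eq_iff\<close>)

lemma planar_field_saddle:
  assumes "a \<noteq> 0" "c \<noteq> 0"
  shows "saddle (planar_field a c p) (vector [- 3 * a\<^sup>2 / (2 * c), 0])" (is "saddle ?F ?z")
proof -
  \<comment> \<open>A nonpositive determinant never exceeds a quarter of the squared trace, so the
    eigenvalues are real.\<close>
  have "4 * (- (3 / 2 * a\<^sup>2)) \<le> (a * ((real p + 4) / 2))\<^sup>2"
    by (rule order_trans[of _ 0]) auto
  then obtain l1 l2 where l: "l1 + l2 = a * ((real p + 4) / 2)" "l1 * l2 = - (3 / 2 * a\<^sup>2)"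
    by (rule real_quadratic_roots)
  have "linear_part_eigenvalues ?F ?z (of_real l1) (of_real l2)"
  proof (rule linear_part_eigenvalues_planar_field)
    \<comment> \<open>Here \<open>2 * c * x = - 3 * a^2\<close>, which turns the determinant
      \<open>3/2 * a^2\<close> of the origin into its negative.\<close>
    show "complex_of_real l1 * of_real l2 = of_real (3 / 2 * a\<^sup>2 + 2 * c * (?z $ 1))"
      unfolding of_real_mult[symmetric] l(2) using assms by simp
  qed (simp only: of_real_add[symmetric] l)
  moreover have "critical_point ?F ?z"
    using assms
    by (simp add: critical_point_def planar_field_def vec_eq_iff forall_2 field_simps power2_eq_square)
  moreover have "l1 * l2 < 0"
    using l assms by simp
  ultimately show ?thesis
    unfolding saddle_def by blast
qed

lemma critical_point_planar_field_origin: "critical_point (planar_field a c p) (vector [0, 0])"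
  by (simp add: critical_point_def planar_field_def vec_eq_iff forall_2)

theorem proposition4p4:
  fixes a c :: real and p :: nat
  assumes "a \<noteq> 0" and "c \<noteq> 0"
  shows "(p \<ge> 1 \<longrightarrow>
            node (planar_field a c p) (vector [0, 0])
            \<and> (a < 0 \<longrightarrow> stable_node (planar_field a c p) (vector [0, 0]))
            \<and> (a > 0 \<longrightarrow> unstable_node (planar_field a c p) (vector [0, 0]))
            \<and> saddle (planar_field a c p) (vector [- 3 * a\<^sup>2 / (2 * c), 0]))
       \<and> (p = 0 \<longrightarrow>
            focus (planar_field a c p) (vector [0, 0])
            \<and> (a < 0 \<longrightarrow> stable_focus (planar_field a c p) (vector [0, 0]))
            \<and> (a > 0 \<longrightarrow> unstable_focus (planar_field a c p) (vector [0, 0]))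
            \<and> saddle (planar_field a c p) (vector [- 3 * a\<^sup>2 / (2 * c), 0]))"
proof -
  let ?F = "planar_field a c p" and ?s = "a * ((real p + 4) / 2)" and ?q = "3 / 2 * a\<^sup>2"
  have "node ?F (vector [0, 0])
      \<and> (a < 0 \<longrightarrow> stable_node ?F (vector [0, 0]))
      \<and> (a > 0 \<longrightarrow> unstable_node ?F (vector [0, 0]))
      \<and> saddle ?F (vector [- 3 * a\<^sup>2 / (2 * c), 0])" if "p \<ge> 1"
  proof -
    \<comment> \<open>After clearing denominators, \<open>4 * q \<le> s^2\<close> reads
      \<open>24 * a^2 \<le> a^2 * (p + 4)^2\<close>, and \<open>p + 4 \<ge> 5\<close>
      suffices.\<close>
    from that have "25 \<le> (real p + 4)\<^sup>2"
      using power_mono[of 5 "real p + 4" 2] by simp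
    then have "a\<^sup>2 * 24 \<le> a\<^sup>2 * (real p + 4)\<^sup>2"
      by (intro mult_left_mono) auto
    then have "4 * ?q \<le> ?s\<^sup>2"
      by (simp add: power_mult_distrib power_divide)
    then obtain l1 l2 where l: "l1 + l2 = ?s" "l1 * l2 = ?q"
      by (rule real_quadratic_roots)
    have eig: "linear_part_eigenvalues ?F (vector [0, 0]) (of_real l1) (of_real l2)"
      by (rule linear_part_eigenvalues_planar_field)
        (simp_all only: of_real_add[symmetric] of_real_mult[symmetric] l, simp_all)
    have pos: "l1 * l2 > 0"
      unfolding l(2) using assms by simp
    \<comment> \<open>A positive product gives equal signs, and the trace, a positive multiple of
      \<open>a\<close>, decides which.\<close>
    have neg_sign: "l1 < 0 \<and> l2 < 0" if "a < 0"
    proof -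
      have "l1 + l2 < 0"
        unfolding l(1) using that by (intro mult_neg_pos) auto
      with pos show ?thesis by (auto simp: zero_less_mult_iff)
    qed
    have pos_sign: "l1 > 0 \<and> l2 > 0" if "a > 0"
    proof -
      have "l1 + l2 > 0"
        unfolding l(1) using that by (intro mult_pos_pos) auto
      with pos show ?thesis by (auto simp: zero_less_mult_iff)
    qed
    show ?thesis
      unfolding node_def stable_node_def unstable_node_def
      using critical_point_planar_field_origin planar_field_saddle[OF assms]
        eig pos neg_sign pos_sign by blast
  qed
  moreover have "focus ?F (vector [0, 0])
      \<and> (a < 0 \<longrightarrow> stable_focus ?F (vector [0, 0]))
      \<and> (a > 0 \<longrightarrow> unstable_focus ?F (vector [0, 0]))
      \<and> saddle ?F (vector [- 3 * a\<^sup>2 / (2 * c), 0])" if "p = 0"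
  proof -
    from that have s: "?s = 2 * a" by simp
    \<comment> \<open>That is, \<open>4 * a^2 < 6 * a^2\<close>: the discriminant is
      negative.\<close>
    have "(2 * a)\<^sup>2 < 4 * ?q"
      using assms by (simp add: power_mult_distrib)
    then obtain \<beta> where \<beta>: "\<beta> \<noteq> 0"
      "Complex (2 * a / 2) \<beta> + Complex (2 * a / 2) (- \<beta>) = of_real (2 * a)"
      "Complex (2 * a / 2) \<beta> * Complex (2 * a / 2) (- \<beta>) = of_real ?q"
      by (rule complex_quadratic_roots)
    have eig: "linear_part_eigenvalues ?F (vector [0, 0]) (Complex a \<beta>) (Complex a (- \<beta>))"
      by (rule linear_part_eigenvalues_planar_field) (use \<beta> s in simp_all)
    show ?thesis
      unfolding focus_def stable_focus_def unstable_focus_def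
      using critical_point_planar_field_origin planar_field_saddle[OF assms]
        eig \<beta>(1) assms(1) by blast
  qed
  ultimately show ?thesis by blast
qed

end
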